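(* Let $L$ and $B$ be commuting matrix ordinary differential operators in $\mathcal{R}_\ell[D]$, and assume that $L=A_0+A_1D$ has order $1$ with invertible leading coefficient $A_1$. Let $f(\lambda,\mu)=\mathrm{DRes}(L-\lambda,B-\mu)\in C[\lambda,\mu]$. Then $f(L,B)(\Psi_\lambda)=\mathbf{0}$ for any fundamental matrix $\Psi_\lambda\in M_\ell(\mathcal{E})$ of the system $LY=\lambda Y$.
   Context: $K$ is a differential field with derivation $\partial$ (write $a'=\partial(a)$) whose field of constants $C$ is algebraically closed of characteristic zero. $\mathcal{R}_\ell=M_\ell(K)$, with entrywise derivation $D(A)=A'$. $\mathcal{R}_\ell[D]$ is the ring of matrix ordinary differential operators $\sum_j B_jD^j$, $B_j\in\mathcal{R}_\ell$, with commutation rule $DA=AD+A'$; operators act on matrices and column vectors with entries in differential extensions of $K$, $D$ acting entrywise. $\mathbf{0}$ is the zero matrix. $\lambda,\mu$ are algebraic variables over $K$ with $\partial\lambda=\partial\mu=0$. For $L=A_0+A_1D$ with $A_1$ invertible and $B=\sum_{j=0}^nB_jD^j$, $n\ge1$, put $N_\lambda=-A_1^{-1}(A_0-\lambda I_\ell)$, $p_0(N_\lambda)=I_\ell$, $p_j(N_\lambda)=p_{j-1}(N_\lambda)N_\lambda+(p_{j-1}(N_\lambda))'$ for $j\ge1$, $M(L-\lambda,B-\mu)=B_0-\mu I_\ell+\sum_{j=1}^nB_jp_j(N_\lambda)$, and $\mathrm{DRes}(L-\lambda,B-\mu)=\det M(L-\lambda,B-\mu)$. When $L$ and $B$ commute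 this is a polynomial in $C[\lambda,\mu]$. For $g=\sum a_{i,j}\lambda^i\mu^j\in C[\lambda,\mu]$, $g(L,B)=\sum a_{i,j}L^iB^j\in\mathcal{R}_\ell[D]$. $\overline{\mathcal F}$ is an algebraic closure of the differential field $\mathcal{F}=K(\lambda,\mu)$, with the extended derivation; its field of constants $\mathcal{C}$ is algebraically closed. $\mathcal{E}$ is a Picard-Vessiot extension of $\overline{\mathcal F}$ (with field of constants $\mathcal{C}$) for the system $DY=N_\lambda Y$, which is equivalent to $LY=\lambda Y$. A fundamental matrix is an invertible $\Psi_\lambda\in M_\ell(\mathcal{E})$ with $D\Psi_\lambda=N_\lambda\Psi_\lambda$, equivalently $L\Psi_\lambda=\lambda\Psi_\lambda$. *)

theory Defs
  imports
    "HOL-Analysis.Analysis"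
    "HOL-Computational_Algebra.Computational_Algebra"
begin

definition derivation :: "('a::comm_ring_1 \<Rightarrow> 'a) \<Rightarrow> bool" where
  "derivation d \<longleftrightarrow>
     (\<forall>x y. d (x + y) = d x + d y) \<and> (\<forall>x y. d (x * y) = d x * y + x * d y)"

definition constants :: "('a::comm_ring_1 \<Rightarrow> 'a) \<Rightarrow> 'a set" where
  "constants d = {c. d c = 0}"

definition constants_alg_closed :: "('a::field \<Rightarrow> 'a) \<Rightarrow> bool" where
  "constants_alg_closed d \<longleftrightarrow>
     (\<forall>p. degree p > 0 \<and> (\<forall>i. coeff p i \<in> constants d)
        \<longrightarrow> (\<exists>c \<in> constants d. poly p c = 0))"

definition ring_embedding :: "('a::comm_ring_1 \<Rightarrow> 'b::comm_ring_1) \<Rightarrow> bool" where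
  "ring_embedding h \<longleftrightarrow> inj h \<and> h 1 = 1 \<and>
     (\<forall>x y. h (x + y) = h x + h y) \<and> (\<forall>x y. h (x * y) = h x * h y)"

definition differential_embedding ::
  "('a::comm_ring_1 \<Rightarrow> 'a) \<Rightarrow> ('b::comm_ring_1 \<Rightarrow> 'b) \<Rightarrow> ('a \<Rightarrow> 'b) \<Rightarrow> bool" where
  "differential_embedding d d' h \<longleftrightarrow>
     derivation d \<and> derivation d' \<and> ring_embedding h \<and> (\<forall>x. d' (h x) = h (d x))"

definition algebraic_closure :: "('a::field \<Rightarrow> 'b::alg_closed_field) \<Rightarrow> bool" where
  "algebraic_closure h \<longleftrightarrow> ring_embedding h \<and>
     (\<forall>x. \<exists>p. p \<noteq> 0 \<and> poly (map_poly h p) x = 0)"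

definition is_subfield :: "'a::field set \<Rightarrow> bool" where
  "is_subfield S \<longleftrightarrow> 0 \<in> S \<and> 1 \<in> S \<and>
     (\<forall>x\<in>S. \<forall>y\<in>S. x + y \<in> S \<and> x * y \<in> S) \<and> (\<forall>x\<in>S. - x \<in> S \<and> inverse x \<in> S)"

definition generated_field :: "'a::field set \<Rightarrow> 'a set" where
  "generated_field H = \<Inter>{S. is_subfield S \<and> H \<subseteq> S}"

definition fundamental_matrix ::
  "('e::field \<Rightarrow> 'e) \<Rightarrow> 'e^'n^'n \<Rightarrow> 'e^'n^'n \<Rightarrow> bool" where
  "fundamental_matrix d N \<Psi> \<longleftrightarrow> invertible \<Psi> \<and> map_matrix d \<Psi> = N ** \<Psi>"

definition picard_vessiot ::
  "('f::field \<Rightarrow> 'f) \<Rightarrow> ('e::field \<Rightarrow> 'e) \<Rightarrow> ('f \<Rightarrow> 'e) \<Rightarrow> 'f^'n^'n \<Rightarrow> bool" where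
  "picard_vessiot dF dE h N \<longleftrightarrow>
     differential_embedding dF dE h \<and>
     constants dE = h ` constants dF \<and>
     (\<exists>\<Psi>. fundamental_matrix dE (map_matrix h N) \<Psi> \<and>
          generated_field (range h \<union> {\<Psi> $ i $ j | i j. True}) = UNIV)"

text \<open>The operator \<open>\<Sum>j. B\<^sub>j D\<^sup>j\<close> is encoded by the polynomial with coefficients \<open>B\<^sub>j\<close>, so that
  \<^const>\<open>degree\<close> is its order.  Only the additive structure and the coefficients of the type of
  polynomials are used: the product \<open>*\<close> and the unit \<open>1\<close> on \<open>'k^'n^'n\<close> are the componentwise
  ones, hence those of \<open>('k^'n^'n) poly\<close> are not the ones of the ring of operators.\<close>

text \<open>Left multiplication by \<open>D\<close>: \<open>D (\<Sum>j. B\<^sub>j D\<^sup>j) = \<Sum>j. B\<^sub>j D\<^sup>j\<^sup>+\<^sup>1 + B\<^sub>j' D\<^sup>j\<close>.\<close>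

definition op_D :: "('k::field \<Rightarrow> 'k) \<Rightarrow> ('k^'n^'n) poly \<Rightarrow> ('k^'n^'n) poly" where
  "op_D d Q = pCons 0 Q + map_poly (map_matrix d) Q"

definition op_mult ::
  "('k::field \<Rightarrow> 'k) \<Rightarrow> ('k^'n^'n) poly \<Rightarrow> ('k^'n^'n) poly \<Rightarrow> ('k^'n^'n) poly" where
  "op_mult d P Q = (\<Sum>i\<le>degree P. map_poly (\<lambda>X. coeff P i ** X) ((op_D d ^^ i) Q))"

definition op_power ::
  "('k::field \<Rightarrow> 'k) \<Rightarrow> ('k^'n^'n) poly \<Rightarrow> nat \<Rightarrow> ('k^'n^'n) poly" where
  "op_power d P i = (op_mult d P ^^ i) [:mat 1:]"

lemma op_D_commutation_rule:
  assumes "derivation d"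
  shows "op_mult d [:0, mat 1:] [:A:] = op_mult d [:A:] [:0, mat 1:] + [:map_matrix d A:]"
proof (cases "A = 0")
  case True
  have "d 0 = 0"
    using assms unfolding derivation_def by (metis add_cancel_right_right)
  then have "map_matrix d 0 = (0 :: 'a^'b^'b)"
    by (simp add: vec_eq_iff)
  with True show ?thesis
    by (simp add: op_mult_def op_D_def map_poly_pCons)
next
  case False
  have "(mat 1 :: 'a^'b^'b) \<noteq> 0"
    by (auto simp: vec_eq_iff mat_def)
  moreover have "d 0 = 0"
    using assms unfolding derivation_def by (metis add_cancel_right_right)
  then have "map_matrix d 0 = (0 :: 'a^'b^'b)"
    by (simp add: vec_eq_iff)
  ultimately show ?thesis
    using False by (simp add: op_mult_def op_D_def map_poly_pCons)
qed

text \<open>Action on matrices over a differential extension with embedding \<open>h\<close> and derivation \<open>dE\<close>.\<close>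

definition op_apply ::
  "('k::field \<Rightarrow> 'e::field) \<Rightarrow> ('e \<Rightarrow> 'e) \<Rightarrow> ('k^'n^'n) poly \<Rightarrow> 'e^'n^'n \<Rightarrow> 'e^'n^'n" where
  "op_apply h dE P Y = (\<Sum>j\<le>degree P. map_matrix h (coeff P j) ** (map_matrix dE ^^ j) Y)"

text \<open>\<open>K[\<lambda>,\<mu>]\<close> is \<open>'k poly poly\<close>, with \<open>\<lambda>\<close> the inner and \<open>\<mu>\<close> the outer variable: the
  coefficient of \<open>\<lambda>\<^sup>i \<mu>\<^sup>j\<close> in \<open>g\<close> is \<open>coeff (coeff g j) i\<close>.\<close>

definition const2 :: "'k::field \<Rightarrow> 'k poly poly" where
  "const2 a = [:[:a:]:]"

definition lam :: "'k::field poly poly" where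
  "lam = [:[:0, 1:]:]"

definition mu :: "'k::field poly poly" where
  "mu = [:0, 1:]"

text \<open>The derivation of \<open>K[\<lambda>,\<mu>]\<close> extending the one of \<open>K\<close>, with \<open>\<lambda>' = \<mu>' = 0\<close>.\<close>

definition deriv2 :: "('k::field \<Rightarrow> 'k) \<Rightarrow> 'k poly poly \<Rightarrow> 'k poly poly" where
  "deriv2 d = map_poly (map_poly d)"

definition N_lam :: "('k::field^'n^'n) poly \<Rightarrow> 'k poly poly^'n^'n" where
  "N_lam L = - (map_matrix const2 (matrix_inv (coeff L 1)) **
                (map_matrix const2 (coeff L 0) - mat lam))"

primrec p_seq :: "('a::comm_ring_1 \<Rightarrow> 'a) \<Rightarrow> 'a^'n^'n \<Rightarrow> nat \<Rightarrow> 'a^'n^'n" where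
  "p_seq d N 0 = mat 1"
| "p_seq d N (Suc j) = p_seq d N j ** N + map_matrix d (p_seq d N j)"

definition M_res ::
  "('k::field \<Rightarrow> 'k) \<Rightarrow> ('k^'n^'n) poly \<Rightarrow> ('k^'n^'n) poly \<Rightarrow> 'k poly poly^'n^'n" where
  "M_res d L B = map_matrix const2 (coeff B 0) - mat mu +
     (\<Sum>j=1..degree B. map_matrix const2 (coeff B j) ** p_seq (deriv2 d) (N_lam L) j)"

definition DRes ::
  "('k::field \<Rightarrow> 'k) \<Rightarrow> ('k^'n^'n) poly \<Rightarrow> ('k^'n^'n) poly \<Rightarrow> 'k poly poly" where
  "DRes d L B = det (M_res d L B)"

definition has_constant_coeffs :: "('k::field \<Rightarrow> 'k) \<Rightarrow> 'k poly poly \<Rightarrow> bool" where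
  "has_constant_coeffs d g \<longleftrightarrow> (\<forall>i j. coeff (coeff g j) i \<in> constants d)"

text \<open>\<open>g(L,B) = \<Sum> a\<^sub>i\<^sub>j L\<^sup>i B\<^sup>j\<close>, a scalar \<open>a\<close> being identified with the operator \<open>a I\<close> of order 0.\<close>

definition op_eval ::
  "('k::field \<Rightarrow> 'k) \<Rightarrow> 'k poly poly \<Rightarrow> ('k^'n^'n) poly \<Rightarrow> ('k^'n^'n) poly \<Rightarrow> ('k^'n^'n) poly" where
  "op_eval d g L B = (\<Sum>j\<le>degree g. \<Sum>i\<le>degree (coeff g j).
     op_mult d [:mat (coeff (coeff g j) i):] (op_mult d (op_power d L i) (op_power d B j)))"

end

theory Submission
  imports Defs
begin

text \<open>On solutions of \<open>Y' = N\<^sub>\<lambda> Y\<close> the operator \<open>B\<close> acts as left multiplication by the matrix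
  \<open>T = \<Sum>j. B\<^sub>j p\<^sub>j(N\<^sub>\<lambda>)\<close>, which has entries in \<open>K[\<lambda>]\<close>, and \<open>f = det (T - \<mu>)\<close>. As \<open>B\<close> commutes with
  \<open>L\<close>, it maps solutions of \<open>L Y = \<lambda> Y\<close> to solutions, so \<open>T \<Psi> = \<Psi> G\<close> with a constant matrix \<open>G\<close>.
  Hence \<open>f = det (G - \<mu>)\<close> is constant, and \<open>L\<^sup>i B\<^sup>j \<Psi> = \<lambda>\<^sup>i \<Psi> G\<^sup>j = \<lambda>\<^sup>i T\<^sup>j \<Psi>\<close>, so that
  \<open>f(L, B) \<Psi> = f(\<lambda>, T) \<Psi> = 0\<close> by the Cayley-Hamilton theorem for \<open>T\<close> over \<open>K[\<lambda>]\<close>.\<close>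

section \<open>Matrices over commutative rings\<close>

lemma matrix_sum_distrib_right:
  fixes A :: "'a::comm_ring_1^'n^'n"
  shows "sum F S ** A = (\<Sum>i\<in>S. F i ** A)"
  by (simp add: matrix_matrix_mult_def vec_eq_iff sum_component sum_distrib_right sum.swap[of _ S])

lemma matrix_sum_distrib_left:
  fixes A :: "'a::comm_ring_1^'n^'n"
  shows "A ** sum F S = (\<Sum>i\<in>S. A ** F i)"
  by (simp add: matrix_matrix_mult_def vec_eq_iff sum_component sum_distrib_left sum.swap[of _ S])

lemma matrix_diff_distrib_right:
  fixes A B C :: "'a::comm_ring_1^'n^'n"
  shows "(A - B) ** C = A ** C - B ** C"
  by (simp add: matrix_matrix_mult_def vec_eq_iff left_diff_distrib sum_subtractf)

lemma matrix_diff_distrib_left: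
  fixes A B C :: "'a::comm_ring_1^'n^'n"
  shows "C ** (A - B) = C ** A - C ** B"
  by (simp add: matrix_matrix_mult_def vec_eq_iff right_diff_distrib sum_subtractf)

lemma matrix_minus_left:
  fixes A B :: "'a::comm_ring_1^'n^'n"
  shows "(- A) ** B = - (A ** B)"
  by (simp add: matrix_matrix_mult_def vec_eq_iff sum_negf)

lemma matrix_minus_right:
  fixes A B :: "'a::comm_ring_1^'n^'n"
  shows "A ** (- B) = - (A ** B)"
  by (simp add: matrix_matrix_mult_def vec_eq_iff sum_negf)

lemma matrix_zero_left [simp]: "0 ** (A :: 'a::comm_ring_1^'p^'n) = 0"
  by (simp add: matrix_matrix_mult_def vec_eq_iff)

lemma matrix_zero_right [simp]: "(A :: 'a::comm_ring_1^'n^'m) ** 0 = 0"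
  by (simp add: matrix_matrix_mult_def vec_eq_iff)

lemma matrix_add_distrib_right:
  fixes A B :: "'a::comm_ring_1^'n^'m" and C :: "'a^'p^'n"
  shows "(A + B) ** C = A ** C + B ** C"
  by (simp add: matrix_matrix_mult_def vec_eq_iff distrib_right sum.distrib)

lemma mat_mult_nth [simp]: "(mat c ** A) $ i $ j = c * (A :: 'a::comm_ring_1^'n^'n) $ i $ j"
  by (simp add: matrix_matrix_mult_def mat_def if_distrib if_distribR cong: if_cong)

lemma mult_mat_nth [simp]: "(A ** mat c) $ i $ j = c * (A :: 'a::comm_ring_1^'n^'n) $ i $ j"
  by (simp add: matrix_matrix_mult_def mat_def if_distrib if_distribR mult.commute cong: if_cong)

lemma mat_mult_commute: "mat c ** A = (A :: 'a::comm_ring_1^'n^'n) ** mat c"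
  by (simp add: vec_eq_iff)

lemma matrix_funpow_intertwine:
  fixes T G P :: "'a::comm_ring_1^'n^'n"
  assumes "P ** G = T ** P"
  shows "P ** ((**) G ^^ j) (mat 1) = ((**) T ^^ j) (mat 1) ** P"
proof (induction j)
  case (Suc j)
  have "P ** ((**) G ^^ Suc j) (mat 1) = (T ** P) ** ((**) G ^^ j) (mat 1)"
    by (simp add: matrix_mul_assoc assms)
  also have "\<dots> = T ** (P ** ((**) G ^^ j) (mat 1))"
    by (simp add: matrix_mul_assoc)
  also have "\<dots> = ((**) T ^^ Suc j) (mat 1) ** P"
    by (simp add: Suc.IH matrix_mul_assoc)
  finally show ?case .
qed simp

text \<open>The (k, j) cofactor is obtained by replacing row k by the j-th unit vector, so that no
  smaller index type for minors has to be introduced.\<close>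

definition adjugate :: "'a::comm_ring_1^'n^'n \<Rightarrow> 'a^'n^'n" where
  "adjugate A = (\<chi> j k. det (\<chi> i. if i = k then axis j 1 else A $ i))"

text \<open>Multilinearity in row k turns entry (i, k) of the product into the determinant of
  \<open>A\<close> with row k replaced by row i. For i = k this is \<open>det A\<close>; otherwise
  two rows agree and it vanishes.\<close>

lemma mult_adjugate: "A ** adjugate A = mat (det (A :: 'a::comm_ring_1^'n^'n))"
proof -
  have "(A ** adjugate A) $ i $ k = mat (det A) $ i $ k" for i k
  proof -
    have "(A ** adjugate A) $ i $ k =
        (\<Sum>j\<in>UNIV. det (\<chi> r. if r = k then A $ i $ j *s axis j 1 else A $ r))"
      by (simp add: matrix_matrix_mult_def adjugate_def det_row_mul)
    also have "\<dots> = det (\<chi> r. if r = k then (\<Sum>j\<in>UNIV. A $ i $ j *s axis j 1) else A $ r)"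
      by (simp add: det_linear_row_sum)
    also have "(\<Sum>j\<in>UNIV. A $ i $ j *s axis j 1) = A $ i"
      by (simp add: basis_expansion)
    also have "det (\<chi> r. if r = k then A $ i else A $ r) = mat (det A) $ i $ k"
    proof (cases "i = k")
      case True
      then have "(\<chi> r. if r = k then A $ i else A $ r) = A"
        by (simp add: vec_eq_iff)
      with True show ?thesis by (simp add: mat_def)
    next
      case False
      then have "det (\<chi> r. if r = k then A $ i else A $ r) = 0"
        by (intro det_identical_rows[OF False]) (simp add: row_def vec_eq_iff)
      with False show ?thesis by (simp add: mat_def)
    qed
    finally show ?thesis .
  qed
  then show ?thesis by (simp add: vec_eq_iff)
qed

text \<open>Comparing coefficients in \<open>(T - x) adj(T - x) = p(x) I\<close> gives \<open>p\<^sub>k I = T C\<^sub>k - C\<^sub>k\<^sub>-\<^sub>1\<close>, where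
  \<open>C\<^sub>k\<close> are the coefficients of the adjugate, and \<open>\<Sum>k. T\<^sup>k p\<^sub>k\<close> telescopes.\<close>

theorem Cayley_Hamilton:
  fixes T :: "'a::comm_ring_1^'n^'n"
  defines "p \<equiv> det (map_matrix (\<lambda>a. [:a:]) T - mat [:0, 1:])"
  shows "(\<Sum>k\<le>degree p. mat (coeff p k) ** ((**) T ^^ k) (mat 1)) = 0"
proof -
  define Q where "Q = adjugate (map_matrix (\<lambda>a. [:a:]) T - mat [:0, 1:])"
  define C where "C k = (map_matrix (\<lambda>q. coeff q k) Q)" for k
  define c where "c k = mat (coeff p k) ** ((**) T ^^ k) (mat 1)" for k
  have Q: "map_matrix (\<lambda>a. [:a:]) T ** Q - mat [:0, 1:] ** Q = mat p"
    unfolding Q_def p_def matrix_diff_distrib_right[symmetric] by (rule mult_adjugate)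
  have TC: "map_matrix (\<lambda>q. coeff q k) (map_matrix (\<lambda>a. [:a:]) T ** Q) = T ** C k" for k
    by (simp add: vec_eq_iff matrix_matrix_mult_def C_def coeff_sum)
  have coeff_mat: "map_matrix (\<lambda>q. coeff q k) (mat p) = mat (coeff p k)" for k
    by (simp add: vec_eq_iff mat_def)
  \<comment> \<open>For k = 0 the predecessor is 0, because the entries of
    \<open>mat [:0, 1:] ** Q\<close> have no constant term.\<close>
  have coeffs: "mat (coeff p k) = T ** C k - (case k of 0 \<Rightarrow> 0 | Suc i \<Rightarrow> C i)" for k
  proof -
    have "mat (coeff p k) = map_matrix (\<lambda>q. coeff q k) (map_matrix (\<lambda>a. [:a:]) T ** Q)
        - map_matrix (\<lambda>q. coeff q k) (mat [:0, 1:] ** Q)"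
      unfolding coeff_mat[symmetric] Q[symmetric] by (simp add: vec_eq_iff)
    also have "map_matrix (\<lambda>q. coeff q k) (mat [:0, 1:] ** Q) = (case k of 0 \<Rightarrow> 0 | Suc i \<Rightarrow> C i)"
      by (cases k) (simp_all add: vec_eq_iff C_def)
    finally show ?thesis unfolding TC .
  qed
  have comm: "((**) T ^^ k) (mat 1) ** T = T ** ((**) T ^^ k) (mat 1)" for k
    by (rule matrix_funpow_intertwine[of T T T, symmetric]) simp
  have tele: "(\<Sum>k\<le>n. c k) = ((**) T ^^ Suc n) (mat 1) ** C n" for n
  proof (induction n)
    case 0
    show ?case using coeffs[of 0] by (simp add: c_def)
  next
    case (Suc n)
    have "c (Suc n) = ((**) T ^^ Suc n) (mat 1) ** (T ** C (Suc n) - C n)"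
      using coeffs[of "Suc n"] mat_mult_commute[of "coeff p (Suc n)" "((**) T ^^ Suc n) (mat 1)"]
      by (simp only: c_def nat.case)
    also have "\<dots> = ((**) T ^^ Suc (Suc n)) (mat 1) ** C (Suc n) - ((**) T ^^ Suc n) (mat 1) ** C n"
      using comm[of "Suc n"] by (simp only: matrix_diff_distrib_left matrix_mul_assoc funpow.simps o_apply)
    finally show ?case by (simp only: sum.atMost_Suc Suc.IH) simp
  qed
  \<comment> \<open>\<open>N\<close> exceeds every degree in the adjugate, so \<open>C N = 0\<close>
    and the telescoped sum vanishes. It also exceeds \<open>degree p\<close>, so summing up to
    \<open>N\<close> adds only zero terms.\<close>
  define N where "N = Max (range (\<lambda>(i, j). degree (Q $ i $ j))) + degree p + 1"
  have "degree (Q $ i $ j) < N" for i j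
  proof -
    have "degree (Q $ i $ j) \<le> Max (range (\<lambda>(i, j). degree (Q $ i $ j)))"
      by (rule Max_ge) (auto intro: image_eqI[of _ _ "(i, j)"])
    then show ?thesis by (simp add: N_def)
  qed
  then have "C N = 0"
    by (simp add: C_def vec_eq_iff coeff_eq_0)
  have mat0: "mat 0 ** X = 0" for X :: "'a^'n^'n"
    by (simp add: vec_eq_iff)
  have "(\<Sum>k\<le>degree p. c k) = (\<Sum>k\<le>N. c k)"
    by (rule sum.mono_neutral_left) (auto simp: N_def c_def coeff_eq_0 mat0)
  also have "\<dots> = 0"
    by (simp add: tele \<open>C N = 0\<close>)
  finally show ?thesis by (simp add: c_def)
qed

section \<open>Embeddings and derivations acting entrywise\<close>

lemma ring_embedding_simps:
  assumes "ring_embedding h"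
  shows "h 0 = 0" "h 1 = 1" "h (x + y) = h x + h y" "h (x * y) = h x * h y"
    "h (- x) = - h x" "h (x - y) = h x - h y" "h x = 0 \<longleftrightarrow> x = 0"
proof -
  show 1: "h 1 = 1" and add: "h (x + y) = h x + h y" and "h (x * y) = h x * h y" for x y
    using assms by (auto simp: ring_embedding_def)
  show z: "h 0 = 0" using add[of 0 0] by simp
  show m: "h (- x) = - h x" for x
    using add[of x "- x"] z by (simp add: eq_neg_iff_add_eq_0 add.commute)
  show "h (x - y) = h x - h y" using add[of x "- y"] m[of y] by simp
  have "inj h" using assms by (simp add: ring_embedding_def)
  then show "h x = 0 \<longleftrightarrow> x = 0" using z by (metis injD)
qed

lemma ring_embedding_sum:
  assumes "ring_embedding h" shows "h (sum g S) = (\<Sum>i\<in>S. h (g i))"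
  by (induction S rule: infinite_finite_induct) (simp_all add: ring_embedding_simps[OF assms])

lemma ring_embedding_prod:
  assumes "ring_embedding h" shows "h (prod g S) = (\<Prod>i\<in>S. h (g i))"
  by (induction S rule: infinite_finite_induct) (simp_all add: ring_embedding_simps[OF assms])

lemma ring_embedding_power:
  assumes "ring_embedding h" shows "h (x ^ n) = h x ^ n"
  by (induction n) (simp_all add: ring_embedding_simps[OF assms])

lemma ring_embedding_sign:
  assumes "ring_embedding h" shows "h (of_int (sign p)) = of_int (sign p)"
  by (simp add: sign_def ring_embedding_simps[OF assms])

lemma map_matrix_embedding:
  assumes "ring_embedding h"
  shows "map_matrix h (A ** B) = map_matrix h A ** map_matrix h B"
    "map_matrix h (X + Y) = map_matrix h X + map_matrix h Y"
    "map_matrix h (X - Y) = map_matrix h X - map_matrix h Y"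
    "map_matrix h (- X) = - map_matrix h X"
    "map_matrix h 0 = 0"
    "map_matrix h (mat c) = mat (h c)"
    "map_matrix h (sum F S) = (\<Sum>i\<in>S. map_matrix h (F i))"
  by (simp_all add: vec_eq_iff matrix_matrix_mult_def ring_embedding_simps[OF assms]
      ring_embedding_sum[OF assms] mat_def sum_component)

lemma det_map_matrix:
  assumes "ring_embedding h"
  shows "det (map_matrix h A) = h (det A)"
  by (simp add: det_def ring_embedding_sum[OF assms] ring_embedding_prod[OF assms]
      ring_embedding_simps[OF assms] ring_embedding_sign[OF assms])

lemma ring_embedding_pCons: "ring_embedding (\<lambda>a::'a::comm_ring_1. [:a:])"
  by (auto simp: ring_embedding_def inj_def one_pCons)

lemma ring_embedding_compose:
  "ring_embedding g \<Longrightarrow> ring_embedding h \<Longrightarrow> ring_embedding (\<lambda>x. h (g x))"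
  by (auto simp: ring_embedding_def inj_def)

lemma differential_embedding_compose:
  "differential_embedding d1 d2 g \<Longrightarrow> differential_embedding d2 d3 h \<Longrightarrow>
    differential_embedding d1 d3 (\<lambda>x. h (g x))"
  using ring_embedding_compose[of g h] by (auto simp: differential_embedding_def)

lemma derivation_simps:
  assumes "derivation d"
  shows "d 0 = 0" "d 1 = 0" "d (x + y) = d x + d y" "d (x * y) = d x * y + x * d y" "d (- x) = - d x"
proof -
  show add: "d (x + y) = d x + d y" and mult: "d (x * y) = d x * y + x * d y" for x y
    using assms by (auto simp: derivation_def)
  show z: "d 0 = 0" using add[of 0 0] by simp
  show "d 1 = 0" using mult[of 1 1] by simp
  show "d (- x) = - d x"
    using add[of x "- x"] z by (simp add: eq_neg_iff_add_eq_0 add.commute)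
qed

lemma derivation_sum:
  assumes "derivation d" shows "d (sum g S) = (\<Sum>i\<in>S. d (g i))"
  by (induction S rule: infinite_finite_induct) (simp_all add: derivation_simps[OF assms])

lemma derivation_prod_constant:
  assumes "derivation d" "\<And>i. i \<in> S \<Longrightarrow> d (g i) = 0" shows "d (prod g S) = 0"
  using assms(2)
  by (induction S rule: infinite_finite_induct) (simp_all add: derivation_simps[OF assms(1)])

lemma derivation_power_constant:
  assumes "derivation d" "d x = 0" shows "d (x ^ n) = 0"
  by (induction n) (simp_all add: derivation_simps[OF assms(1)] assms(2))

lemma map_matrix_derivation:
  assumes "derivation d"
  shows "map_matrix d (A ** B) = map_matrix d A ** B + A ** map_matrix d B"
    "map_matrix d 0 = 0"
    "map_matrix d (X + Y) = map_matrix d X + map_matrix d Y"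
    "map_matrix d (sum F S) = (\<Sum>i\<in>S. map_matrix d (F i))"
  by (simp_all add: vec_eq_iff matrix_matrix_mult_def derivation_simps[OF assms]
      derivation_sum[OF assms] sum_component sum.distrib)

lemma map_matrix_derivation_mat:
  assumes "derivation d" "d c = 0" shows "map_matrix d (mat c) = 0"
  by (simp add: vec_eq_iff mat_def derivation_simps[OF assms(1)] assms(2))

lemma map_matrix_derivation_funpow_constant:
  fixes G :: "'a::comm_ring_1^'n^'n"
  assumes "derivation d" "map_matrix d G = 0"
  shows "map_matrix d (((**) G ^^ j) (mat 1)) = 0"
proof (induction j)
  case 0
  show ?case
    by (simp add: map_matrix_derivation_mat[OF assms(1)] derivation_simps(2)[OF assms(1)])
next
  case (Suc j)
  then show ?case by (simp add: map_matrix_derivation[OF assms(1)] assms(2))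
qed

text \<open>The determinant is an integer polynomial in the entries, so the Leibniz rule kills it
  term by term.\<close>

lemma derivation_det_constant:
  assumes "derivation d" "map_matrix d G = 0"
  shows "d (det G) = 0"
proof -
  have G: "d (G $ i $ j) = 0" for i j
    using assms(2) by (simp add: vec_eq_iff)
  have "d (\<Prod>i\<in>UNIV. G $ i $ p i) = 0" for p
    by (rule derivation_prod_constant[OF assms(1)]) (simp add: G)
  moreover have "d (of_int (sign p)) = 0" for p :: "'b \<Rightarrow> 'b"
    by (simp add: sign_def derivation_simps[OF assms(1)])
  ultimately show ?thesis
    by (simp add: det_def derivation_sum[OF assms(1)] derivation_simps[OF assms(1)])
qed

section \<open>The action of operators\<close>

lemma funpow_map_matrix_constant:
  assumes "derivation d" "map_matrix d G = 0"
  shows "(map_matrix d ^^ j) (Y ** G) = (map_matrix d ^^ j) Y ** G"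
  by (induction j) (simp_all add: map_matrix_derivation[OF assms(1)] assms(2))

text \<open>Coefficients multiply from the left and \<open>dE\<close> passes over a constant right
  factor, so every operator is linear over constant matrices on the right.\<close>

lemma op_apply_mult_constant:
  assumes "derivation dE" "map_matrix dE G = 0"
  shows "op_apply h dE P (Y ** G) = op_apply h dE P Y ** G"
  by (simp add: op_apply_def funpow_map_matrix_constant[OF assms] matrix_sum_distrib_right
      matrix_mul_assoc)

text \<open>Coefficients beyond the degree are 0. A free upper bound lets operators of different
  orders be summed over one range.\<close>

lemma op_apply_altdef:
  assumes "ring_embedding h" "degree P \<le> n"
  shows "op_apply h dE P Y = (\<Sum>j\<le>n. map_matrix h (coeff P j) ** (map_matrix dE ^^ j) Y)"
  unfolding op_apply_def
  by (rule sum.mono_neutral_left)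
    (use assms in \<open>auto simp: coeff_eq_0 map_matrix_embedding[OF assms(1)]\<close>)

lemma op_apply_0 [simp]: "ring_embedding h \<Longrightarrow> op_apply h dE 0 Y = 0"
  by (simp add: op_apply_def map_matrix_embedding)

lemma op_apply_add:
  assumes "ring_embedding h"
  shows "op_apply h dE (P + Q) Y = op_apply h dE P Y + op_apply h dE Q Y"
proof -
  define n where "n = max (degree P) (degree Q)"
  have "degree (P + Q) \<le> n" "degree P \<le> n" "degree Q \<le> n"
    by (auto simp: n_def degree_add_le_max)
  then show ?thesis
    by (simp add: op_apply_altdef[OF assms, where n = n] map_matrix_embedding[OF assms]
        matrix_add_distrib_right sum.distrib)
qed

lemma op_apply_sum:
  assumes "ring_embedding h"
  shows "op_apply h dE (sum F S) Y = (\<Sum>i\<in>S. op_apply h dE (F i) Y)"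
  by (induction S rule: infinite_finite_induct) (simp_all add: op_apply_add assms)

lemma op_apply_pCons_0: "op_apply h dE [:A:] Y = map_matrix h A ** Y"
  by (simp add: op_apply_def)

lemma op_apply_map_poly_mult:
  assumes "ring_embedding h"
  shows "op_apply h dE (map_poly (\<lambda>X. A ** X) Q) Y = map_matrix h A ** op_apply h dE Q Y"
proof -
  have "op_apply h dE (map_poly (\<lambda>X. A ** X) Q) Y =
      (\<Sum>j\<le>degree Q. map_matrix h (A ** coeff Q j) ** (map_matrix dE ^^ j) Y)"
    by (subst op_apply_altdef[OF assms map_poly_degree_leq]) (simp_all add: coeff_map_poly)
  then show ?thesis
    by (simp add: op_apply_def matrix_sum_distrib_left map_matrix_embedding[OF assms] matrix_mul_assoc)
qed

text \<open>By the Leibniz rule \<open>(B_j Y^(j))' = B_j Y^(j+1) + B_j' Y^(j)\<close>; the two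
  terms come from the shifted and the differentiated summand of \<open>op_D\<close>.\<close>

lemma op_apply_op_D:
  assumes "differential_embedding d dE h"
  shows "op_apply h dE (op_D d Q) Y = map_matrix dE (op_apply h dE Q Y)"
proof -
  have h: "ring_embedding h" and d: "derivation d" and dE: "derivation dE"
    and comm: "\<And>x. dE (h x) = h (d x)"
    using assms by (auto simp: differential_embedding_def)
  define n where "n = degree Q"
  have shift: "op_apply h dE (pCons 0 Q) Y =
      (\<Sum>j\<le>n. map_matrix h (coeff Q j) ** map_matrix dE ((map_matrix dE ^^ j) Y))"
    by (subst op_apply_altdef[OF h degree_pCons_le])
      (simp add: sum.atMost_Suc_shift map_matrix_embedding[OF h] n_def del: sum.atMost_Suc)
  have deriv: "op_apply h dE (map_poly (map_matrix d) Q) Y =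
      (\<Sum>j\<le>n. map_matrix dE (map_matrix h (coeff Q j)) ** (map_matrix dE ^^ j) Y)"
  proof -
    have "map_matrix h (map_matrix d X) = map_matrix dE (map_matrix h X)" for X :: "'a^'c^'c"
      by (simp add: vec_eq_iff comm)
    then show ?thesis
      by (subst op_apply_altdef[OF h map_poly_degree_leq])
        (simp_all add: coeff_map_poly map_matrix_derivation[OF d] n_def)
  qed
  show ?thesis
    unfolding op_D_def op_apply_add[OF h] shift deriv
    by (simp add: op_apply_def map_matrix_derivation[OF dE] sum.distrib n_def add.commute)
qed

text \<open>\<open>op_mult\<close> is built from iterates of \<open>op_D\<close>, each acting as one
  derivation. In this way commuting operators yield commuting actions.\<close>

lemma op_apply_op_mult:
  assumes "differential_embedding d dE h"
  shows "op_apply h dE (op_mult d P Q) Y = op_apply h dE P (op_apply h dE Q Y)"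
proof -
  have h: "ring_embedding h"
    using assms by (auto simp: differential_embedding_def)
  have "op_apply h dE ((op_D d ^^ i) Q) Y = (map_matrix dE ^^ i) (op_apply h dE Q Y)" for i
    by (induction i) (simp_all add: op_apply_op_D[OF assms])
  then show ?thesis
    by (simp add: op_mult_def op_apply_sum[OF h] op_apply_map_poly_mult[OF h]
        op_apply_def[of h dE P])
qed

lemma op_apply_op_power:
  assumes "differential_embedding d dE h"
  shows "op_apply h dE (op_power d P i) Y = (op_apply h dE P ^^ i) Y"
proof (induction i)
  case 0
  have "ring_embedding h"
    using assms by (auto simp: differential_embedding_def)
  then show ?case
    by (simp add: op_power_def op_apply_pCons_0 map_matrix_embedding ring_embedding_simps)
next
  case (Suc i)
  then show ?case
    by (simp add: op_power_def op_apply_op_mult[OF assms])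
qed

lemma op_apply_op_eval:
  assumes "differential_embedding d dE h"
  shows "op_apply h dE (op_eval d g L B) Y =
    (\<Sum>j\<le>degree g. \<Sum>i\<le>degree (coeff g j). mat (h (coeff (coeff g j) i)) **
      (op_apply h dE L ^^ i) ((op_apply h dE B ^^ j) Y))"
proof -
  have "ring_embedding h"
    using assms by (auto simp: differential_embedding_def)
  then show ?thesis
    by (simp add: op_eval_def op_apply_sum op_apply_op_mult[OF assms] op_apply_op_power[OF assms]
        op_apply_pCons_0 map_matrix_embedding)
qed

lemma op_apply_order_1:
  assumes "degree L = 1"
  shows "op_apply h dE L Y =
    map_matrix h (coeff L 0) ** Y + map_matrix h (coeff L 1) ** map_matrix dE Y"
  by (simp add: op_apply_def assms)

text \<open>Here \<open>A1'\<close> is the inverse of \<open>A1\<close>, while \<open>Y'\<close>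
  stands for the derivative of \<open>Y\<close>; solving for it is pure algebra. The backward
  direction will serve \<Psi>, the forward one \<open>T ** \<Psi>\<close>.\<close>

lemma order_1_eigen_iff:
  fixes A0 A1 A1' Y Y' :: "'a::comm_ring_1^'n^'n"
  assumes "A1 ** A1' = mat 1" "A1' ** A1 = mat 1"
  shows "A0 ** Y + A1 ** Y' = mat l ** Y \<longleftrightarrow> Y' = - (A1' ** (A0 - mat l)) ** Y"
proof
  assume "A0 ** Y + A1 ** Y' = mat l ** Y"
  then have "A1 ** Y' = - ((A0 - mat l) ** Y)"
    by (simp add: matrix_diff_distrib_right algebra_simps eq_diff_eq)
  then have "A1' ** (A1 ** Y') = - (A1' ** ((A0 - mat l) ** Y))"
    by (simp add: matrix_minus_right)
  then show "Y' = - (A1' ** (A0 - mat l)) ** Y"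
    by (simp add: matrix_mul_assoc assms matrix_minus_left)
next
  assume "Y' = - (A1' ** (A0 - mat l)) ** Y"
  then have "A1 ** Y' = - ((A1 ** A1') ** ((A0 - mat l) ** Y))"
    by (simp add: matrix_mul_assoc matrix_minus_left matrix_minus_right)
  then show "A0 ** Y + A1 ** Y' = mat l ** Y"
    by (simp add: assms matrix_diff_distrib_right)
qed

text \<open>\<open>(p_j Y)' = p_j' Y + p_j N Y\<close>, which is the recursion defining
  \<open>p_seq\<close>.\<close>

lemma funpow_map_matrix_p_seq:
  assumes "derivation d" "map_matrix d Y = N ** Y"
  shows "(map_matrix d ^^ j) Y = p_seq d N j ** Y"
  by (induction j) (simp_all add: map_matrix_derivation[OF assms(1)] assms(2)
      matrix_add_distrib_right matrix_mul_assoc add.commute)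

text \<open>Serves to carry the p_j from K[\<lambda>] both to K[\<lambda>,\<mu>] and to the
  Picard-Vessiot field.\<close>

lemma map_matrix_p_seq:
  assumes "ring_embedding h" "\<And>x. d' (h x) = h (d x)"
  shows "map_matrix h (p_seq d N j) = p_seq d' (map_matrix h N) j"
proof (induction j)
  case (Suc j)
  have "map_matrix h (map_matrix d X) = map_matrix d' (map_matrix h X)" for X :: "'a^'c^'c"
    by (simp add: vec_eq_iff assms(2))
  with Suc show ?case by (simp add: map_matrix_embedding[OF assms(1)])
qed (simp add: map_matrix_embedding[OF assms(1)] ring_embedding_simps[OF assms(1)])

text \<open>\<open>D^j\<close> acts on a solution as \<open>p_j(N)\<close>, so a whole operator acts
  as one matrix. The term j = 0 is split off to match the shape of \<open>M_res\<close>.\<close>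

lemma op_apply_p_seq:
  assumes "derivation dE" "ring_embedding h" "map_matrix dE Y = N ** Y"
  shows "op_apply h dE B Y =
    (map_matrix h (coeff B 0) + (\<Sum>j=1..degree B. map_matrix h (coeff B j) ** p_seq dE N j)) ** Y"
proof -
  have "op_apply h dE B Y = (\<Sum>j\<le>degree B. map_matrix h (coeff B j) ** p_seq dE N j) ** Y"
    by (simp add: op_apply_def funpow_map_matrix_p_seq[OF assms(1,3)] matrix_sum_distrib_right
        matrix_mul_assoc)
  also have "(\<Sum>j\<le>degree B. map_matrix h (coeff B j) ** p_seq dE N j) =
      map_matrix h (coeff B 0) + (\<Sum>j=1..degree B. map_matrix h (coeff B j) ** p_seq dE N j)"
    by (simp add: atMost_atLeast0 sum.atLeast_Suc_atMost)
  finally show ?thesis .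
qed

section \<open>The differential resultant as a characteristic polynomial\<close>

lemma map_poly_pCons_0: "g 0 = 0 \<Longrightarrow> map_poly g [:a:] = [:g a:]"
  by (simp add: map_poly_pCons)

text \<open>An embedding of a polynomial ring is determined by its values on the constants and on
  the variable.\<close>

lemma map_poly_sum_degree:
  assumes "ring_embedding h"
  shows "h q = (\<Sum>i\<le>degree q. h [:coeff q i:] * h [:0, 1:] ^ i)"
proof -
  have "h q = h (\<Sum>i\<le>degree q. monom (coeff q i) i)"
    by (simp add: poly_as_sum_of_monoms)
  also have "\<dots> = (\<Sum>i\<le>degree q. h ([:coeff q i:] * [:0, 1:] ^ i))"
    by (simp add: ring_embedding_sum[OF assms] monom_altdef)
  finally show ?thesis
    by (simp only: ring_embedding_simps[OF assms] ring_embedding_power[OF assms])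
qed

text \<open>Entries of \<^const>\<open>N_lam\<close> and of \<open>M_res + \<mu> I\<close> do not involve \<open>\<mu>\<close>. Descending them to
  \<open>K[\<lambda>]\<close> exhibits the differential resultant as a characteristic polynomial in \<open>\<mu>\<close>.\<close>

definition N_lam1 :: "('k::field^'n^'n) poly \<Rightarrow> 'k poly^'n^'n" where
  "N_lam1 L = - (map_matrix (\<lambda>a. [:a:]) (matrix_inv (coeff L 1)) **
                (map_matrix (\<lambda>a. [:a:]) (coeff L 0) - mat [:0, 1:]))"

definition T_res ::
  "('k::field \<Rightarrow> 'k) \<Rightarrow> ('k^'n^'n) poly \<Rightarrow> ('k^'n^'n) poly \<Rightarrow> 'k poly^'n^'n" where
  "T_res d L B = map_matrix (\<lambda>a. [:a:]) (coeff B 0) +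
     (\<Sum>j=1..degree B. map_matrix (\<lambda>a. [:a:]) (coeff B j) ** p_seq (map_poly d) (N_lam1 L) j)"

lemma map_matrix_const2: "map_matrix const2 A = map_matrix (\<lambda>p. [:p:]) (map_matrix (\<lambda>a. [:a:]) A)"
  by (simp add: vec_eq_iff const2_def)

lemma N_lam_eq: "N_lam L = map_matrix (\<lambda>p. [:p:]) (N_lam1 L)"
  unfolding N_lam_def N_lam1_def map_matrix_const2 lam_def
  by (simp add: map_matrix_embedding[OF ring_embedding_pCons])

text \<open>\<open>deriv2 d\<close> sends \<open>[:p:]\<close> to \<open>[:map_poly d p:]\<close>,
  so the recursion for the p_j can be run in K[\<lambda>]; \<mu> enters only through the scalar
  matrix.\<close>

lemma M_res_eq:
  assumes "derivation d"
  shows "M_res d L B = map_matrix (\<lambda>p. [:p:]) (T_res d L B) - mat [:0, 1:]"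
proof -
  have "deriv2 d [:p:] = [:map_poly d p:]" for p
    by (simp add: deriv2_def map_poly_pCons_0)
  then have "map_matrix (\<lambda>p. [:p:]) (p_seq (map_poly d) (N_lam1 L) j) =
      p_seq (deriv2 d) (N_lam L) j" for j
    unfolding N_lam_eq by (intro map_matrix_p_seq[OF ring_embedding_pCons])
  then show ?thesis
    unfolding M_res_def T_res_def map_matrix_const2 mu_def
    by (simp add: map_matrix_embedding[OF ring_embedding_pCons])
qed

theorem theorem1:
  fixes dK :: "'k::field_char_0 \<Rightarrow> 'k"
    and dF :: "'k poly poly fract \<Rightarrow> 'k poly poly fract"
    and dFbar :: "'f::alg_closed_field \<Rightarrow> 'f"
    and dE :: "'e::field \<Rightarrow> 'e"
    and \<phi> :: "'k poly poly fract \<Rightarrow> 'f"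
    and \<psi> :: "'f \<Rightarrow> 'e"
    and L B :: "('k^'n^'n) poly"
    and f :: "'k poly poly"
    and \<Psi> :: "'e^'n^'n"
  assumes "derivation dK" and "constants_alg_closed dK"
    and "differential_embedding (deriv2 dK) dF to_fract"
    and "differential_embedding dF dFbar \<phi>" and "algebraic_closure \<phi>"
    and "op_mult dK L B = op_mult dK B L"
    and "degree L = 1" and "invertible (coeff L 1)"
    and "picard_vessiot dFbar dE \<psi> (map_matrix (\<lambda>p. \<phi> (to_fract p)) (N_lam L))"
    and "f = DRes dK L B"
    and "fundamental_matrix dE (map_matrix (\<lambda>p. \<psi> (\<phi> (to_fract p))) (N_lam L)) \<Psi>"
  shows "has_constant_coeffs dK f \<and>
    op_apply (\<lambda>a. \<psi> (\<phi> (to_fract (const2 a)))) dE (op_eval dK f L B) \<Psi> = 0"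
proof -
  \<comment> \<open>\<open>\<iota>\<close>, \<open>\<iota>'\<close> and \<open>h\<close> embed
    K[\<lambda>,\<mu>], K[\<lambda>] and K into the field of \<open>dE\<close>, and \<open>l\<close>
    is the image of \<lambda>. \<open>T1\<close> lives over K[\<lambda>], where Cayley-Hamilton will
    be applied; \<open>T\<close> is its image.\<close>
  define \<iota> where "\<iota> p = \<psi> (\<phi> (to_fract p))" for p :: "'k poly poly"
  define \<iota>' where "\<iota>' q = \<iota> [:q:]" for q
  define h where "h a = \<iota> (const2 a)" for a
  define l where "l = \<iota> lam"
  define N where "N = map_matrix \<iota> (N_lam L)"
  define T1 where "T1 = T_res dK L B"
  define T where "T = map_matrix \<iota>' T1"
  define ap :: "('k^'n^'n) poly \<Rightarrow> 'e^'n^'n \<Rightarrow> 'e^'n^'n" where "ap = op_apply h dE"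

  \<comment> \<open>Compatibility of the embeddings with the derivations\<close>
  have emb: "differential_embedding (deriv2 dK) dE \<iota>"
  proof -
    have "differential_embedding dFbar dE \<psi>"
      using assms(9) by (simp add: picard_vessiot_def)
    from differential_embedding_compose[OF differential_embedding_compose[OF assms(3,4)] this]
    show ?thesis by (simp add: \<iota>_def[abs_def])
  qed
  then have \<iota>: "ring_embedding \<iota>" and dE: "derivation dE"
    and \<iota>_comm: "\<And>p. dE (\<iota> p) = \<iota> (deriv2 dK p)"
    by (auto simp: differential_embedding_def)
  have d0: "dK 0 = 0" "dK 1 = 0"
    using assms(1) by (simp_all add: derivation_simps)
  have \<iota>': "ring_embedding \<iota>'"
    unfolding \<iota>'_def by (rule ring_embedding_compose[OF ring_embedding_pCons \<iota>])
  have \<iota>'_comm: "dE (\<iota>' q) = \<iota>' (map_poly dK q)" for q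
    by (simp add: \<iota>'_def \<iota>_comm deriv2_def map_poly_pCons_0)
  have h_eq: "h a = \<iota>' [:a:]" for a
    by (simp add: h_def \<iota>'_def const2_def)
  have \<iota>'_const: "map_matrix \<iota>' (map_matrix (\<lambda>a. [:a:]) X) = map_matrix h X" for X :: "'k^'n^'n"
    by (simp add: vec_eq_iff h_eq)
  have h: "ring_embedding h"
    unfolding h_eq by (rule ring_embedding_compose[OF ring_embedding_pCons \<iota>'])
  have h_emb: "differential_embedding dK dE h"
    using h assms(1) dE by (simp add: differential_embedding_def h_eq \<iota>'_comm map_poly_pCons_0 d0)
  have l_eq: "l = \<iota>' [:0, 1:]"
    by (simp add: l_def \<iota>'_def lam_def)
  have dl: "dE l = 0"
    by (simp add: l_eq \<iota>'_comm map_poly_pCons d0 ring_embedding_simps[OF \<iota>'])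
  have "map_poly dK 1 = 0"
    by (simp add: poly_eq_iff coeff_map_poly coeff_1 d0)
  then have d\<mu>: "dE (\<iota> mu) = 0"
    by (simp add: mu_def \<iota>_comm deriv2_def map_poly_pCons ring_embedding_simps[OF \<iota>])

  \<comment> \<open>Solutions of LY = \<lambda>Y and the action of B on them\<close>
  have \<Psi>: "map_matrix dE \<Psi> = N ** \<Psi>" and inv: "invertible \<Psi>"
    using assms(11) by (simp_all add: fundamental_matrix_def N_def \<iota>_def[abs_def])
  obtain \<Phi> where \<Phi>: "\<Psi> ** \<Phi> = mat 1" "\<Phi> ** \<Psi> = mat 1"
    using inv by (auto simp: invertible_def)

  have N_eq: "N = map_matrix \<iota>' (N_lam1 L)"
    by (simp add: N_def N_lam_eq vec_eq_iff \<iota>'_def)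
  have "N = - (map_matrix h (matrix_inv (coeff L 1)) ** (map_matrix h (coeff L 0) - mat l))"
    by (simp add: N_eq N_lam1_def map_matrix_embedding[OF \<iota>'] \<iota>'_const l_eq)
  moreover have "coeff L 1 ** matrix_inv (coeff L 1) = mat 1"
    "matrix_inv (coeff L 1) ** coeff L 1 = mat 1"
    using someI_ex[OF assms(8)[unfolded invertible_def]] unfolding matrix_inv_def by auto
  then have "map_matrix h (coeff L 1) ** map_matrix h (matrix_inv (coeff L 1)) = mat 1"
    "map_matrix h (matrix_inv (coeff L 1)) ** map_matrix h (coeff L 1) = mat 1"
    by (simp_all flip: map_matrix_embedding(1)[OF h]
        add: map_matrix_embedding(6)[OF h] ring_embedding_simps(2)[OF h])
  ultimately have eigen_iff: "ap L Y = mat l ** Y \<longleftrightarrow> map_matrix dE Y = N ** Y" for Y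
    unfolding ap_def op_apply_order_1[OF assms(7)] using order_1_eigen_iff by simp

  have B\<Psi>: "ap B \<Psi> = T ** \<Psi>"
  proof -
    have "T = map_matrix h (coeff B 0) +
        (\<Sum>j=1..degree B. map_matrix h (coeff B j) ** p_seq dE N j)"
      by (simp add: T_def T1_def T_res_def map_matrix_embedding[OF \<iota>'] \<iota>'_const N_eq
          map_matrix_p_seq[of \<iota>' dE "map_poly dK", OF \<iota>' \<iota>'_comm])
    then show ?thesis
      unfolding ap_def using op_apply_p_seq[OF dE h \<Psi>] by simp
  qed

  \<comment> \<open>The constant matrix of B on the solution space\<close>
  have mat_l: "map_matrix dE (mat l) = (0 :: 'e^'n^'n)"
    by (rule map_matrix_derivation_mat[OF dE dl])
  have "ap L (ap B \<Psi>) = ap B (ap L \<Psi>)"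
    using op_apply_op_mult[OF h_emb, of L B] op_apply_op_mult[OF h_emb, of B L] assms(6)
    by (simp add: ap_def)
  \<comment> \<open>The scalar \<lambda> is moved to the right, where it is a constant factor that
    \<open>B\<close> passes over.\<close>
  also have "ap L \<Psi> = \<Psi> ** mat l"
    using eigen_iff[of \<Psi>] \<Psi> by (simp add: mat_mult_commute)
  also have "ap B (\<Psi> ** mat l) = mat l ** ap B \<Psi>"
    unfolding ap_def by (simp add: op_apply_mult_constant[OF dE mat_l] mat_mult_commute)
  finally have T\<Psi>: "map_matrix dE (T ** \<Psi>) = N ** (T ** \<Psi>)"
    by (simp only: eigen_iff B\<Psi>)
  \<comment> \<open>The matrix of \<open>B\<close> with respect to the basis of solutions given by
    the columns of \<Psi>.\<close>
  define G where "G = \<Phi> ** T ** \<Psi>"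
  have \<Psi>G: "\<Psi> ** G = T ** \<Psi>"
    by (simp add: G_def matrix_mul_assoc \<Phi>)
  have dG: "map_matrix dE G = 0"
  proof -
    \<comment> \<open>Both \<Psi> and \<open>\<Psi> ** G\<close> solve the system, so in the product
      rule only the term with the derivative of \<open>G\<close> is left over, and it must
      vanish.\<close>
    have "N ** (\<Psi> ** G) = map_matrix dE (\<Psi> ** G)"
      using T\<Psi> by (simp only: \<Psi>G)
    also have "\<dots> = N ** (\<Psi> ** G) + \<Psi> ** map_matrix dE G"
      by (simp add: map_matrix_derivation[OF dE] \<Psi> matrix_mul_assoc)
    finally have "\<Psi> ** map_matrix dE G = 0" by simp
    then have "(\<Phi> ** \<Psi>) ** map_matrix dE G = 0"
      by (simp flip: matrix_mul_assoc)
    then show ?thesis by (simp add: \<Phi>)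
  qed

  \<comment> \<open>This is the polynomial \<open>p\<close> of \<open>Cayley_Hamilton\<close> for
    \<open>T1\<close>, with \<mu> as its variable.\<close>
  have f_eq: "f = det (map_matrix (\<lambda>q. [:q:]) T1 - mat [:0, 1:])"
    by (simp add: assms(10) DRes_def M_res_eq[OF assms(1)] T1_def)

  \<comment> \<open>Constancy of the coefficients of f\<close>
  have "has_constant_coeffs dK f"
  proof -
    have "\<iota> f = det (T - mat (\<iota> mu))"
    proof -
      have "map_matrix \<iota> (map_matrix (\<lambda>q. [:q:]) T1) = T"
        by (simp add: vec_eq_iff T_def \<iota>'_def)
      then show ?thesis
        by (simp add: f_eq flip: det_map_matrix[OF \<iota>] add: map_matrix_embedding[OF \<iota>] mu_def)
    qed
    also have "\<dots> = det (G - mat (\<iota> mu))"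
    proof -
      \<comment> \<open>\<Psi> conjugates \<open>G\<close> into \<open>T\<close>, hence also their
        shifts by \<mu>; \<open>det \<Psi>\<close> is nonzero and cancels.\<close>
      have "(T - mat (\<iota> mu)) ** \<Psi> = \<Psi> ** (G - mat (\<iota> mu))"
        by (simp add: matrix_diff_distrib_left matrix_diff_distrib_right \<Psi>G mat_mult_commute)
      then have "det (T - mat (\<iota> mu)) * det \<Psi> = det \<Psi> * det (G - mat (\<iota> mu))"
        by (simp flip: det_mul)
      then show ?thesis
        using inv by (simp add: invertible_det_nz)
    qed
    finally have "dE (\<iota> f) = dE (det (G - mat (\<iota> mu)))" by simp
    also have "\<dots> = 0"
    proof (rule derivation_det_constant[OF dE])
      have "map_matrix dE (G - mat (\<iota> mu)) = map_matrix dE (G + mat (- \<iota> mu))"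
        by (simp add: vec_eq_iff mat_def)
      then show "map_matrix dE (G - mat (\<iota> mu)) = 0"
        by (simp add: map_matrix_derivation[OF dE] dG map_matrix_derivation_mat[OF dE]
            derivation_simps[OF dE] d\<mu>)
    qed
    \<comment> \<open>Injectivity of \<open>\<iota>\<close> brings the vanishing back to
      K[\<lambda>,\<mu>], where it can be read off coefficient by coefficient.\<close>
    finally have "deriv2 dK f = 0"
      by (simp add: \<iota>_comm ring_embedding_simps[OF \<iota>])
    then have "coeff (coeff (deriv2 dK f) j) i = 0" for i j
      by simp
    then show ?thesis
      by (simp add: has_constant_coeffs_def constants_def deriv2_def coeff_map_poly d0)
  qed

  \<comment> \<open>Vanishing of f(L, B) on the fundamental matrix\<close>
  moreover have "ap (op_eval dK f L B) \<Psi> = 0"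
  proof -
    define Tp where "Tp j = ((**) T ^^ j) (mat 1)" for j
    define Gp where "Gp j = ((**) G ^^ j) (mat 1)" for j
    have \<Psi>Gp: "\<Psi> ** Gp j = Tp j ** \<Psi>" for j
      unfolding Gp_def Tp_def by (rule matrix_funpow_intertwine[OF \<Psi>G])
    have dGp: "map_matrix dE (Gp j) = 0" for j
      unfolding Gp_def by (rule map_matrix_derivation_funpow_constant[OF dE dG])
    \<comment> \<open>The powers are computed with \<open>G\<close> on the right, since
      \<open>T\<close> need not be constant and \<open>B\<close> need not pass over it.\<close>
    have Bj: "(ap B ^^ j) \<Psi> = \<Psi> ** Gp j" for j
    proof (induction j)
      case (Suc j)
      have "ap B (\<Psi> ** Gp j) = ap B \<Psi> ** Gp j"
        unfolding ap_def by (rule op_apply_mult_constant[OF dE dGp])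
      with Suc show ?case by (simp add: B\<Psi> Gp_def matrix_mul_assoc flip: \<Psi>G)
    qed (simp add: Gp_def)
    have Li: "(ap L ^^ i) (\<Psi> ** Gp j) = mat (l ^ i) ** (\<Psi> ** Gp j)" for i j
    proof (induction i)
      case (Suc i)
      \<comment> \<open>With \<lambda> also moved into the constant right factor, \<open>L\<close>
        meets only \<Psi> and contributes one more factor \<open>l\<close>.\<close>
      have Gl: "map_matrix dE (Gp j ** mat (l ^ i)) = 0"
        by (simp add: map_matrix_derivation[OF dE] dGp
            map_matrix_derivation_mat[OF dE derivation_power_constant[OF dE dl]])
      have "ap L (\<Psi> ** (Gp j ** mat (l ^ i))) = (mat l ** \<Psi>) ** (Gp j ** mat (l ^ i))"
        using eigen_iff[of \<Psi>] \<Psi> unfolding ap_def by (simp add: op_apply_mult_constant[OF dE Gl])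
      also have "\<dots> = (mat l ** (\<Psi> ** Gp j)) ** mat (l ^ i)"
        by (simp only: matrix_mul_assoc)
      also have "\<dots> = mat (l ^ Suc i) ** (\<Psi> ** Gp j)"
        by (simp add: vec_eq_iff mult.left_commute mult.assoc)
      also have "\<Psi> ** (Gp j ** mat (l ^ i)) = mat (l ^ i) ** (\<Psi> ** Gp j)"
        by (simp add: mat_mult_commute[of "l ^ i" "\<Psi> ** Gp j"] flip: matrix_mul_assoc)
      finally show ?case
        using Suc by simp
    qed (simp add: vec_eq_iff)
    have "ap (op_eval dK f L B) \<Psi> = (\<Sum>j\<le>degree f. \<Sum>i\<le>degree (coeff f j).
        mat (h (coeff (coeff f j) i)) ** (mat (l ^ i) ** (Tp j ** \<Psi>)))"
      unfolding ap_def op_apply_op_eval[OF h_emb] by (simp only: ap_def[symmetric] Bj Li[unfolded \<Psi>Gp] \<Psi>Gp)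
    also have "\<dots> = (\<Sum>j\<le>degree f. (mat (\<iota>' (coeff f j)) ** Tp j) ** \<Psi>)"
    proof (rule sum.cong)
      fix j
      \<comment> \<open>The inner sum is the coefficient of \<open>\<mu>^j\<close> in f, evaluated
        at the image of \<lambda>.\<close>
      have "\<iota>' (coeff f j) = (\<Sum>i\<le>degree (coeff f j). h (coeff (coeff f j) i) * l ^ i)"
        unfolding h_eq l_eq by (rule map_poly_sum_degree[OF \<iota>'])
      then show "(\<Sum>i\<le>degree (coeff f j).
          mat (h (coeff (coeff f j) i)) ** (mat (l ^ i) ** (Tp j ** \<Psi>))) =
          (mat (\<iota>' (coeff f j)) ** Tp j) ** \<Psi>"
        by (simp add: vec_eq_iff sum_component sum_distrib_right mult.assoc flip: matrix_mul_assoc)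
    qed simp
    \<comment> \<open>The coefficients of f in \<mu> lie in K[\<lambda>], so the sum is the image of
      f evaluated at \<open>T1\<close>.\<close>
    also have "\<dots> = map_matrix \<iota>' (\<Sum>j\<le>degree f. mat (coeff f j) ** ((**) T1 ^^ j) (mat 1)) ** \<Psi>"
    proof -
      have "map_matrix \<iota>' (((**) T1 ^^ j) (mat 1)) = Tp j" for j
        by (induction j) (simp_all add: Tp_def T_def map_matrix_embedding[OF \<iota>']
            ring_embedding_simps[OF \<iota>'])
      then show ?thesis
        by (simp add: map_matrix_embedding[OF \<iota>'] matrix_sum_distrib_right)
    qed
    also have "\<dots> = 0"
      unfolding f_eq Cayley_Hamilton by (simp add: map_matrix_embedding[OF \<iota>'])
    finally show ?thesis .
  qed
  ultimately show ?thesis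
    by (simp add: ap_def h_def[abs_def] \<iota>_def)
qed

end
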